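(* Let $d\geq 1$ be an integer and let $A=(A(i,j))_{1\leq i,j\leq d}$ be a real square matrix with positive entries. Let $\lambda$ be the Perron--Frobenius eigenvalue of $A$ and let $\mu$ be the left Perron--Frobenius eigenvector of $A$, normalised so that the sum of its components is equal to $1$. Then, with $E_i$, $\tau_i$, $(X_n)_{n\in\mathbb{N}}$ and $S$ associated to $A$ as in the context, $$\forall i\in\{1,\dots,d\}\qquad \mu(i)=\frac{1}{\displaystyle E_i\Bigg(\sum_{n=0}^{\tau_i-1}\Big(\lambda^{-n}\prod_{t=0}^{n-1}S(X_t)\Big)\Bigg)}.$$
   Context: Let $A=(A(i,j))_{1\leq i,j\leq d}$ be a $d\times d$ real matrix with all entries positive. For $i\in\{1,\dots,d\}$ set $S(i)=\sum_{j=1}^d A(i,j)$ and for $i,j\in\{1,\dots,d\}$ set $M(i,j)=A(i,j)/S(i)$, so that $M=(M(i,j))_{1\le i,j\le d}$ is a stochastic matrix. Let $(X_n)_{n\in\mathbb{N}}$ ($\mathbb{N}=\{0,1,2,\dots\}$) be a Markov chain with state space $\{1,\dots,d\}$ and transition matrix $M$. For $i\in\{1,\dots,d\}$, $E_i$ denotes the expectation for the chain started from $X_0=i$, and $\tau_i=\inf\{n\geq 1: X_n=i\}$ is the time of first return to $i$. For each $i$, let $$\forall\lambda\geq 0\qquad \phi_i(\lambda)=E_i\Bigg(\lambda^{-\tau_i}\prod_{n=0}^{\tau_i-1}S(X_n)\Bigg)\in[0,+\infty],$$ let $\lambda_i$ be the unique positive real number such that $\phi_i(\lambda_i)=1$,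 and let $\mu_i$ be the vector with components $$\mu_i(j)=E_i\Bigg(\sum_{n=0}^{\tau_i-1}\Big(1_{\{X_n=j\}}\,\lambda_i^{-n}\prod_{k=0}^{n-1}S(X_k)\Big)\Bigg),\qquad 1\le j\le d.$$ The values $\lambda_1,\dots,\lambda_d$ are all equal; their common value $\lambda$ is the Perron--Frobenius eigenvalue of $A$, and it is a simple eigenvalue. The vectors $\mu_1,\dots,\mu_d$ are proportional left eigenvectors of $A$ associated to $\lambda$ with positive components; the left Perron--Frobenius eigenvector $\mu$ is the vector obtained by normalising any of them so that the sum of the components is $1$ (so $\mu A=\lambda\mu$ and $\sum_{i}\mu(i)=1$). Empty products are equal to $1$. *)

theory Defs
  imports "HOL-Probability.Probability" "Jordan_Normal_Form.Spectral_Radius"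
begin

(* Both HOL-Analysis and Jordan_Normal_Form declare the infix $; keep the latter. *)
unbundle no vec_syntax

(* Indices are 0-based: the state space {1, ..., d} is rendered as {..<d}. *)

definition row_sum :: "real mat \<Rightarrow> nat \<Rightarrow> real" where
  "row_sum A i = (\<Sum>j<dim_col A. A $$ (i, j))"

definition transition_matrix :: "real mat \<Rightarrow> real mat" where
  "transition_matrix A = mat (dim_row A) (dim_col A) (\<lambda>(i, j). A $$ (i, j) / row_sum A i)"

(* Time-homogeneous; the initial distribution is left free. *)
definition markov_chain :: "real mat \<Rightarrow> 'w measure \<Rightarrow> (nat \<Rightarrow> 'w \<Rightarrow> nat) \<Rightarrow> bool" where
  "markov_chain M P X \<longleftrightarrow>
     prob_space P \<and>
     (\<forall>n. X n \<in> measurable P (count_space {..<dim_row M})) \<and>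
     (\<forall>n x. (\<forall>k\<le>Suc n. x k < dim_row M) \<longrightarrow>
        \<P>(\<omega> in P. \<forall>k\<le>n. X k \<omega> = x k) \<noteq> 0 \<longrightarrow>
        \<P>(\<omega> in P. X (Suc n) \<omega> = x (Suc n) \<bar> \<forall>k\<le>n. X k \<omega> = x k) = M $$ (x n, x (Suc n)))"

(* Inf {} = \<infinity>: the value is \<infinity> when the chain never returns to i. *)
definition return_time :: "(nat \<Rightarrow> 'w \<Rightarrow> nat) \<Rightarrow> nat \<Rightarrow> 'w \<Rightarrow> enat" where
  "return_time X i \<omega> = Inf {enat n | n. n \<ge> 1 \<and> X n \<omega> = i}"

definition perron_frobenius_eigenvalue :: "real mat \<Rightarrow> real \<Rightarrow> bool" where
  "perron_frobenius_eigenvalue A l \<longleftrightarrow>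
     eigenvalue A l \<and> l = spectral_radius (map_mat complex_of_real A)"

(* Row vectors are identified with column vectors, so mu A = l mu reads A\<^sup>T mu = l mu. *)
definition left_perron_frobenius_eigenvector :: "real mat \<Rightarrow> real vec \<Rightarrow> bool" where
  "left_perron_frobenius_eigenvector A mu \<longleftrightarrow>
     (\<exists>l. perron_frobenius_eigenvalue A l \<and> eigenvector (transpose_mat A) mu l) \<and>
     (\<Sum>i<dim_vec mu. mu $ i) = 1"

end

theory Submission
  imports Defs
begin

text \<open>
  Put \<open>f n j = E\<^sub>i (1{n < \<tau>\<^sub>i, X\<^sub>n = j} \<lambda>\<^sup>-\<^sup>n S(X\<^sub>0) \<dots> S(X\<^sub>n\<^sub>-\<^sub>1))\<close>. The Markov property cancels the factor \<open>S\<close>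
  against the denominator of the transition matrix, so \<open>f n\<close> is the \<open>n\<close>-th iterate of the unit
  row vector at \<open>i\<close> under \<open>A / \<lambda>\<close> with its \<open>i\<close>-th column set to zero. The vector \<open>v = \<mu> / \<mu>(i)\<close>
  solves the affine equation satisfied by the sum of these iterates, and it bounds the partial
  sums; a maximal-ratio argument shows that the sum is exactly \<open>v\<close>. Summing over \<open>j\<close> gives
  \<open>1 / \<mu>(i)\<close>.

  Positivity of \<open>\<mu>\<close>: if \<open>|\<mu>| A \<ge> \<lambda> |\<mu>|\<close> were strict somewhere, then \<open>w = |\<mu>| A\<close> would satisfy
  \<open>w A \<ge> r w\<close> with \<open>r > \<lambda>\<close>, and the powers of \<open>A\<close> would grow faster than the spectral radius allows.
\<close>

section \<open>Sums of iterates killed at one state\<close>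

text \<open>Zeroing column \<open>i\<close> discards the mass arriving at \<open>i\<close>. Since
  \<open>v i = 1\<close>, the unit row vector at \<open>i\<close> replaces exactly that mass, so
  \<open>v\<close> solves the affine equation of the sum; positivity of \<open>a\<close> makes the
  solution unique.\<close>

lemma killed_iterates_sums:
  fixes a :: "nat \<Rightarrow> nat \<Rightarrow> real" and v :: "nat \<Rightarrow> real"
  assumes i: "i < d"
    and a: "\<And>k j. k < d \<Longrightarrow> j < d \<Longrightarrow> 0 < a k j"
    and v: "\<And>j. j < d \<Longrightarrow> 0 < v j"
    and fixed: "\<And>j. j < d \<Longrightarrow> (\<Sum>k<d. v k * a k j) = v j"
    and norm: "v i = 1"
    and f0: "\<And>j. f 0 j = of_bool (j = i)"
    and fSuc: "\<And>n j. f (Suc n) j = (if j = i then 0 else \<Sum>k<d. f n k * a k j)"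
    and j: "j < d"
  shows "(\<lambda>n. f n j) sums v j"
proof -
  have f_nonneg: "0 \<le> f n j" if "j < d" for n j
    using that by (induction n arbitrary: j) (auto simp: f0 fSuc intro!: sum_nonneg mult_nonneg_nonneg less_imp_le[OF a])
  have partial_Suc: "(\<Sum>m<Suc n. f m j) = of_bool (j = i) + (if j = i then 0 else \<Sum>k<d. (\<Sum>m<n. f m k) * a k j)" for n j
    by (subst sum.lessThan_Suc_shift)
      (auto simp: f0 fSuc sum_distrib_right intro: sum.swap)
  \<comment> \<open>By \<open>fixed\<close> and \<open>norm\<close>, \<open>v\<close> is a fixed
    point of the recursion \<open>partial_Suc\<close>. That recursion is monotone because
    \<open>a\<close> is nonnegative, so partial sums that start below \<open>v\<close> stay below
    it.\<close>
  have partial_le: "(\<Sum>m<n. f m j) \<le> v j" if "j < d" for n j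
    using that
  proof (induction n arbitrary: j)
    case 0
    then show ?case using v[of j] by simp
  next
    case (Suc n)
    have "(\<Sum>k<d. (\<Sum>m<n. f m k) * a k j) \<le> (\<Sum>k<d. v k * a k j)"
      using Suc a by (intro sum_mono mult_right_mono) (auto intro: less_imp_le)
    then show ?case
      using fixed[OF Suc.prems] norm unfolding partial_Suc by auto
  qed
  have summable: "summable (\<lambda>n. f n j)" if "j < d" for j
    using that f_nonneg partial_le by (intro summableI_nonneg_bounded[where x="v j"]) auto
  \<comment> \<open>The defect \<open>r\<close> solves the homogeneous equation away from
    \<open>i\<close> and vanishes at \<open>i\<close>, where only the term \<open>n = 0\<close>
    contributes to the sum.\<close>
  define r where "r j = v j - (\<Sum>n. f n j)" for j
  have r_nonneg: "0 \<le> r j" if "j < d" for j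
    unfolding r_def using suminf_le_const[OF summable[OF that]] partial_le[OF that] by simp
  have tot_i: "(\<Sum>n. f n i) = 1"
    using suminf_split_head[OF summable[OF i]] by (simp add: f0 fSuc)
  have tot: "(\<Sum>n. f n j) = (\<Sum>k<d. (\<Sum>n. f n k) * a k j)" if "j < d" "j \<noteq> i" for j
  proof -
    have "(\<Sum>n. f n j) = (\<Sum>n. f (Suc n) j)"
      using suminf_split_head[OF summable[OF that(1)]] that by (simp add: f0)
    also have "\<dots> = (\<Sum>n. \<Sum>k<d. f n k * a k j)"
      using that by (simp add: fSuc)
    also have "\<dots> = (\<Sum>k<d. \<Sum>n. f n k * a k j)"
      by (rule suminf_sum) (auto intro: summable_mult2 summable)
    finally show ?thesis by (simp add: suminf_mult2[OF summable])
  qed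
  have r_i: "r i = 0" by (simp add: r_def tot_i norm)
  have r_fixed: "r j = (\<Sum>k<d. r k * a k j)" if "j < d" "j \<noteq> i" for j
    using fixed[OF that(1)] tot[OF that] by (simp add: r_def left_diff_distrib sum_subtractf)
  define c where "c = Max ((\<lambda>k. r k / v k) ` {..<d})"
  have "c \<in> (\<lambda>k. r k / v k) ` {..<d}"
    unfolding c_def using i by (intro Max_in) auto
  then obtain m where m: "m < d" "c = r m / v m" by auto
  have r_le: "r k \<le> c * v k" if "k < d" for k
  proof -
    have "r k / v k \<le> c" unfolding c_def using that by (intro Max_ge) auto
    then show ?thesis using v[OF that] by (simp add: field_simps)
  qed
  \<comment> \<open>The maximal ratio \<open>c\<close> is attained at \<open>m\<close>. If it were
    positive, \<open>m\<close> would differ from \<open>i\<close>, and the term \<open>k = i\<close>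
    in the equation for \<open>r m\<close>, where \<open>r i = 0 < c * v i\<close>, would make the
    bound of \<open>r m\<close> by \<open>c * v m\<close> strict.\<close>
  have "c \<le> 0"
  proof (rule ccontr)
    assume "\<not> c \<le> 0"
    then have c: "0 < c" and "m \<noteq> i" using m r_i by auto
    have "r m = (\<Sum>k<d. r k * a k m)" using r_fixed m \<open>m \<noteq> i\<close> by simp
    also have "\<dots> < (\<Sum>k<d. c * v k * a k m)"
    proof (rule sum_strict_mono_ex1)
      show "\<forall>k\<in>{..<d}. r k * a k m \<le> c * v k * a k m"
        using mult_right_mono[OF r_le less_imp_le[OF a[OF _ m(1)]]] by blast
      show "\<exists>k\<in>{..<d}. r k * a k m < c * v k * a k m"
        using i r_i norm c a[OF i m(1)] by (intro bexI[of _ i]) auto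
    qed simp
    also have "\<dots> = c * v m"
      using fixed[OF m(1)] by (simp add: mult.assoc flip: sum_distrib_left)
    also have "\<dots> = r m" using m v[of m] by simp
    finally show False by simp
  qed
  then have "c * v j \<le> 0" using v[OF j] by (simp add: mult_le_0_iff)
  then have "r j = 0" using r_le[OF j] r_nonneg[OF j] by simp
  then show ?thesis using summable_sums[OF summable[OF j]] by (simp add: r_def)
qed

section \<open>Spectral radius and positivity of the left eigenvector\<close>

text \<open>Below spectral radius 1 the Jordan normal form bounds the entries of all powers of
  \<open>B\<close> uniformly, whereas iterating \<open>growth\<close> makes \<open>w B^n\<close> at
  least \<open>q^n w\<close>.\<close>

lemma growth_le_spectral_radius:
  fixes B :: "real mat" and w :: "nat \<Rightarrow> real"
  assumes B: "B \<in> carrier_mat d d" and d: "0 < d"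
    and B_nonneg: "\<And>i j. i < d \<Longrightarrow> j < d \<Longrightarrow> 0 \<le> B $$ (i, j)"
    and w: "\<And>j. j < d \<Longrightarrow> 0 < w j"
    and growth: "\<And>j. j < d \<Longrightarrow> q * w j \<le> (\<Sum>k<d. w k * B $$ (k, j))"
    and q: "1 < q"
  shows "1 \<le> spectral_radius (map_mat complex_of_real B)"
proof (rule ccontr)
  assume "\<not> ?thesis"
  moreover have "map_mat complex_of_real B \<in> carrier_mat d d" using B by simp
  ultimately obtain c where c: "\<And>n. norm_bound (map_mat complex_of_real B ^\<^sub>m n) c"
    using spectral_radius_jnf_norm_bound_less_1_upper_triangular by (metis not_le)
  have Bn[simp]: "B ^\<^sub>m n \<in> carrier_mat d d" for n using B by simp
  have entry: "(B ^\<^sub>m n) $$ (k, j) \<le> c" if "k < d" "j < d" for n k j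
  proof -
    have "norm ((map_mat complex_of_real B ^\<^sub>m n) $$ (k, j)) \<le> c"
      using c[of n] B that unfolding norm_bound_def by simp
    also have "map_mat complex_of_real B ^\<^sub>m n = map_mat complex_of_real (B ^\<^sub>m n)"
      using of_real_hom.mat_hom_pow[OF B] by metis
    also have "norm (\<dots> $$ (k, j)) = \<bar>(B ^\<^sub>m n) $$ (k, j)\<bar>"
      using carrier_matD[OF Bn[of n]] that by simp
    finally show ?thesis by simp
  qed
  have lower: "q ^ n * w j \<le> (\<Sum>k<d. w k * (B ^\<^sub>m n) $$ (k, j))" if "j < d" for n j
    using that
  proof (induction n arbitrary: j)
    case 0
    then show ?case using B by (simp add: if_distrib[of "\<lambda>x. _ * x"] cong: if_cong)
  next
    case (Suc n)
    have prod: "(B ^\<^sub>m Suc n) $$ (k, j) = (\<Sum>m<d. (B ^\<^sub>m n) $$ (k, m) * B $$ (m, j))" if "k < d" for k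
      using that Suc.prems B carrier_matD[OF Bn[of n]]
      by (simp add: scalar_prod_def atLeast0LessThan)
    have "q ^ Suc n * w j \<le> q ^ n * (\<Sum>m<d. w m * B $$ (m, j))"
      using growth[OF Suc.prems] q by (simp add: mult.assoc mult.left_commute)
    also have "\<dots> = (\<Sum>m<d. (q ^ n * w m) * B $$ (m, j))"
      by (simp add: sum_distrib_left mult.assoc)
    also have "\<dots> \<le> (\<Sum>m<d. (\<Sum>k<d. w k * (B ^\<^sub>m n) $$ (k, m)) * B $$ (m, j))"
      using Suc B_nonneg by (intro sum_mono mult_right_mono) auto
    also have "\<dots> = (\<Sum>k<d. w k * (B ^\<^sub>m Suc n) $$ (k, j))"
      by (simp add: prod sum_distrib_left sum_distrib_right mult.assoc del: pow_mat.simps) (rule sum.swap)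
    finally show ?case .
  qed
  \<comment> \<open>One component, here 0, suffices: \<open>K\<close> does not depend on
    \<open>n\<close>, so it cannot bound a geometric sequence.\<close>
  define K where "K = (\<Sum>k<d. w k * c) / w 0"
  have "q ^ n \<le> K" for n
  proof -
    have "q ^ n * w 0 \<le> (\<Sum>k<d. w k * (B ^\<^sub>m n) $$ (k, 0))" using lower d by simp
    also have "\<dots> \<le> (\<Sum>k<d. w k * c)"
      using entry d w by (intro sum_mono mult_left_mono) (auto intro: less_imp_le)
    finally show ?thesis using w[OF d] by (simp add: K_def field_simps)
  qed
  moreover obtain n where "K < q ^ n" using real_arch_pow[OF q] by blast
  ultimately show False by (metis not_le)
qed

lemma eigenvalue_norm_le_spectral_radius:
  assumes A: "A \<in> carrier_mat d d" and d: "0 < d" and ev: "eigenvalue A k"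
  shows "norm k \<le> spectral_radius A"
  using spectral_radius_mem_max(2)[OF A d] ev unfolding spectrum_def by auto

text \<open>An eigenvector of the scaled matrix for an eigenvalue \<open>k\<close> of maximal
  modulus is an eigenvector of \<open>A\<close> for \<open>k / c\<close>.\<close>

lemma spectral_radius_smult_le:
  assumes A: "A \<in> carrier_mat d d" and d: "0 < d" and c: "c \<noteq> 0"
  shows "spectral_radius (c \<cdot>\<^sub>m A) \<le> norm c * spectral_radius A"
proof -
  have cA: "c \<cdot>\<^sub>m A \<in> carrier_mat d d" using A by simp
  obtain k where k: "eigenvalue (c \<cdot>\<^sub>m A) k" "norm k = spectral_radius (c \<cdot>\<^sub>m A)"
    using spectral_radius_mem_max(1)[OF cA d] unfolding spectrum_def by auto
  from k(1) obtain u where u: "u \<in> carrier_vec d" "u \<noteq> 0\<^sub>v d" "(c \<cdot>\<^sub>m A) *\<^sub>v u = k \<cdot>\<^sub>v u"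
    unfolding eigenvalue_def eigenvector_def using A by auto
  have "A *\<^sub>v u = (k / c) \<cdot>\<^sub>v u"
  proof (rule eq_vecI)
    fix m assume "m < dim_vec ((k / c) \<cdot>\<^sub>v u)"
    then have m: "m < d" using u by simp
    have "c * (row A m \<bullet> u) = k * u $ m"
      using arg_cong[OF u(3), of "\<lambda>z. z $ m"] m u(1) A by simp
    then show "(A *\<^sub>v u) $ m = ((k / c) \<cdot>\<^sub>v u) $ m"
      using m A u(1) c by (simp add: field_simps)
  qed (use A u in simp)
  then have "eigenvalue A (k / c)"
    unfolding eigenvalue_def eigenvector_def using A u by auto
  from eigenvalue_norm_le_spectral_radius[OF A d this] show ?thesis
    using k(2) c by (simp add: norm_divide field_simps)
qed

text \<open>Taking absolute values gives \<open>l |mu| <= |mu| A\<close>, and extremality of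
  \<open>l\<close> turns this into an equality. Equality in the triangle inequality then forces a
  common sign on the components, and \<open>sum_mu\<close> makes that sign positive.\<close>

lemma left_perron_frobenius_positive:
  fixes A :: "real mat" and mu :: "nat \<Rightarrow> real"
  assumes A: "A \<in> carrier_mat d d" and d: "0 < d"
    and pos: "\<And>i j. i < d \<Longrightarrow> j < d \<Longrightarrow> 0 < A $$ (i, j)"
    and l: "l = spectral_radius (map_mat complex_of_real A)"
    and mu: "\<And>j. j < d \<Longrightarrow> (\<Sum>k<d. mu k * A $$ (k, j)) = l * mu j"
    and sum_mu: "(\<Sum>k<d. mu k) = 1"
  shows "0 < l" and "j < d \<Longrightarrow> 0 < mu j"
proof -
  have cA: "map_mat complex_of_real A \<in> carrier_mat d d" using A by simp
  have l_nonneg: "0 \<le> l"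
    using spectral_radius_mem_max(1)[OF cA d] unfolding l by auto
  obtain k0 where k0: "k0 < d" "mu k0 \<noteq> 0"
    using sum_mu by (metis (no_types, lifting) lessThan_iff sum.neutral zero_neq_one)
  define w where "w j = (\<Sum>k<d. \<bar>mu k\<bar> * A $$ (k, j))" for j
  have w_pos: "0 < w j" if "j < d" for j
    unfolding w_def using that k0 pos
    by (intro sum_pos2[of _ k0]) (auto intro!: mult_pos_pos mult_nonneg_nonneg less_imp_le[OF pos])
  have sub: "l * \<bar>mu j\<bar> \<le> w j" if "j < d" for j
  proof -
    have "l * \<bar>mu j\<bar> = \<bar>\<Sum>k<d. mu k * A $$ (k, j)\<bar>"
      using mu[OF that] l_nonneg by (simp add: abs_mult)
    also have "\<dots> \<le> (\<Sum>k<d. \<bar>mu k * A $$ (k, j)\<bar>)" by (rule sum_abs)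
    also have "\<dots> = w j"
      unfolding w_def using pos[OF _ that] by (intro sum.cong) (auto simp: abs_mult less_imp_le)
    finally show ?thesis .
  qed
  have abs_eigen: "w j = l * \<bar>mu j\<bar>" if jd: "j < d" for j
  proof (rule ccontr)
    assume "w j \<noteq> l * \<bar>mu j\<bar>"
    then have strict: "l * \<bar>mu j\<bar> < w j" using sub[OF that] by simp
    \<comment> \<open>All entries of \<open>A\<close> are positive, so strictness at the single
      index \<open>j\<close> spreads: \<open>w A\<close> exceeds \<open>l w\<close> in every
      column.\<close>
    define z where "z m = (\<Sum>k<d. w k * A $$ (k, m))" for m
    have z: "l * w m < z m" if m: "m < d" for m
    proof -
      have "l * w m = (\<Sum>k<d. (l * \<bar>mu k\<bar>) * A $$ (k, m))"
        by (simp add: w_def sum_distrib_left mult.assoc)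
      also have "\<dots> < z m"
        unfolding z_def
      proof (rule sum_strict_mono_ex1)
        show "\<forall>k\<in>{..<d}. l * \<bar>mu k\<bar> * A $$ (k, m) \<le> w k * A $$ (k, m)"
          using sub pos[OF _ m] by (auto intro!: mult_right_mono less_imp_le)
        show "\<exists>k\<in>{..<d}. l * \<bar>mu k\<bar> * A $$ (k, m) < w k * A $$ (k, m)"
          using jd mult_strict_right_mono[OF strict pos[OF jd m]] by blast
      qed simp
      finally show ?thesis .
    qed
    define r where "r = Min ((\<lambda>m. z m / w m) ` {..<d})"
    have "r \<in> (\<lambda>m. z m / w m) ` {..<d}"
      unfolding r_def using d by (intro Min_in) auto
    then have "l < r" using z w_pos by (auto simp: field_simps)
    have r_le: "r * w m \<le> z m" if "m < d" for m
    proof -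
      have "r \<le> z m / w m" unfolding r_def using that by (intro Min_le) auto
      then show ?thesis using w_pos[OF that] by (simp add: field_simps)
    qed
    \<comment> \<open>With \<open>s\<close> strictly between \<open>l\<close> and \<open>r\<close>,
      the growth factor \<open>r / s\<close> of \<open>A / s\<close> is larger than 1 while its
      spectral radius, at most \<open>l / s\<close>, is below 1.\<close>
    define s where "s = (l + r) / 2"
    have s: "0 < s" "l < s" "s < r" using \<open>l < r\<close> l_nonneg by (auto simp: s_def)
    let ?B = "inverse s \<cdot>\<^sub>m A"
    have "1 \<le> spectral_radius (map_mat complex_of_real ?B)"
    proof (rule growth_le_spectral_radius[where w = w and q = "r / s"])
      fix m assume m: "m < d"
      have "r / s * w m \<le> inverse s * z m"
        using r_le[OF m] s by (simp add: field_simps)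
      also have "\<dots> = (\<Sum>k<d. w k * ?B $$ (k, m))"
        using A m by (simp add: z_def sum_distrib_left mult.left_commute)
      finally show "r / s * w m \<le> (\<Sum>k<d. w k * ?B $$ (k, m))" .
    qed (use A d pos w_pos s in \<open>auto intro: less_imp_le\<close>)
    also have "map_mat complex_of_real ?B = complex_of_real (inverse s) \<cdot>\<^sub>m map_mat complex_of_real A"
      using A by (intro eq_matI) auto
    also have "spectral_radius \<dots> \<le> norm (complex_of_real (inverse s)) * l"
      unfolding l by (rule spectral_radius_smult_le[OF cA d]) (use s in simp)
    also have "\<dots> < 1" using s by (simp only: norm_of_real) (simp add: field_simps)
    finally show False by simp
  qed
  have "l * \<bar>mu k0\<bar> > 0" using w_pos[OF k0(1)] abs_eigen[OF k0(1)] by simp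
  then show l_pos: "0 < l" using l_nonneg by (auto simp: zero_less_mult_iff)
  \<comment> \<open>Here \<open>c\<close> stands for the sign of \<open>mu k0\<close>. In column
    \<open>k0\<close> the terms \<open>(|mu m| - c mu m) A(m, k0)\<close> are nonnegative and, by
    the eigenvector equations for \<open>|mu|\<close> and \<open>mu\<close>, sum to 0, so each of
    them vanishes.\<close>
  have same_sign: "mu k = c * \<bar>mu k\<bar>" if k: "k < d" and c: "c * (l * mu k0) = l * \<bar>mu k0\<bar>" "\<bar>c\<bar> = 1" for k c
  proof -
    have nn: "0 \<le> (\<bar>mu m\<bar> - c * mu m) * A $$ (m, k0)" if "m < d" for m
    proof -
      have "c * mu m \<le> \<bar>mu m\<bar>" using c(2) by (metis abs_ge_self abs_mult mult_1)
      then show ?thesis using pos[OF that k0(1)] by simp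
    qed
    have "(\<Sum>m<d. (\<bar>mu m\<bar> - c * mu m) * A $$ (m, k0)) = w k0 - c * (\<Sum>m<d. mu m * A $$ (m, k0))"
      by (simp add: w_def sum_subtractf sum_distrib_left left_diff_distrib mult.assoc)
    also have "\<dots> = 0" using abs_eigen[OF k0(1)] mu[OF k0(1)] c(1) by auto
    finally have "(\<bar>mu k\<bar> - c * mu k) * A $$ (k, k0) = 0"
      using nn k by (subst (asm) sum_nonneg_eq_0_iff) auto
    then have "\<bar>mu k\<bar> = c * mu k" using pos[OF k k0(1)] by simp
    moreover have "c * c = 1" using c(2) by (metis abs_mult_self_eq mult_1)
    ultimately show ?thesis by (metis mult.assoc mult_1)
  qed
  have mu_sgn: "mu k = sgn (mu k0) * \<bar>mu k\<bar>" if "k < d" for k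
    using that k0 by (intro same_sign) (auto simp: sgn_if)
  \<comment> \<open>A negative sign of \<open>mu k0\<close> would give \<open>1 = - T\<close> with
    \<open>T\<close> nonnegative.\<close>
  define T where "T = (\<Sum>k<d. \<bar>mu k\<bar>)"
  have "1 = sgn (mu k0) * T"
    unfolding T_def sum_mu[symmetric] sum_distrib_left using mu_sgn by (intro sum.cong) auto
  moreover have "0 \<le> T" by (simp add: T_def)
  ultimately have "0 < mu k0"
    using k0(2) by (auto simp: sgn_if split: if_splits)
  then have "mu j = \<bar>mu j\<bar>" if "j < d" using mu_sgn[OF that] by simp
  moreover have "\<bar>mu j\<bar> > 0" if "j < d"
    using w_pos[OF that] abs_eigen[OF that] l_pos by (simp add: zero_less_mult_iff)
  ultimately show "0 < mu j" if "j < d" using that by simp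
qed

section \<open>The Markov property and the return time\<close>

text \<open>The definition \<open>markov_chain\<close> only speaks of conditioning on a full path of
  positive probability. Because \<open>g\<close> sees only the times up to \<open>n\<close> and the
  state space is finite, both integrals are finite sums over cylinder events, where that condition
  applies term by term.\<close>

lemma markov_chain_step:
  fixes g :: "(nat \<Rightarrow> nat) \<Rightarrow> real"
  assumes chain: "markov_chain M P X"
    and M_nonneg: "\<And>k. k < dim_row M \<Longrightarrow> 0 \<le> M $$ (k, j)"
    and j: "j < dim_row M"
    and g_nonneg: "\<And>x. 0 \<le> g x"
    and g_local: "\<And>x y. (\<And>k. k \<le> n \<Longrightarrow> x k = y k) \<Longrightarrow> g x = g y"
  shows "(\<integral>\<^sup>+\<omega>. ennreal (g (\<lambda>t. X t \<omega>) * of_bool (X (Suc n) \<omega> = j)) \<partial>P) =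
    (\<integral>\<^sup>+\<omega>. ennreal (g (\<lambda>t. X t \<omega>) * M $$ (X n \<omega>, j)) \<partial>P)"
proof -
  define d where "d = dim_row M"
  interpret prob_space P using chain by (simp add: markov_chain_def)
  have X[measurable]: "X t \<in> measurable P (count_space {..<d})" for t
    using chain by (simp add: markov_chain_def d_def)
  have X_lt: "X t \<omega> < d" if "\<omega> \<in> space P" for t \<omega>
    using measurable_space[OF X that, of t] by simp
  \<comment> \<open>Extensional functions give exactly one representative per path up to time
    \<open>n\<close>, so the cylinders \<open>C x\<close> with \<open>x\<close> in
    \<open>paths\<close> are disjoint and cover the space.\<close>
  define paths where "paths = PiE {..n} (\<lambda>_. {..<d})"
  define C where "C x = {\<omega>\<in>space P. \<forall>k\<le>n. X k \<omega> = x k}" for x :: "nat \<Rightarrow> nat"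
  have paths_fin: "finite paths" unfolding paths_def by (intro finite_PiE) auto
  have E[measurable]: "{\<omega>\<in>space P. X t \<omega> = a} \<in> events" for t a
    by measurable
  have C[measurable]: "C x \<in> events" for x
    unfolding C_def by measurable
  have decompose: "ennreal (h (\<lambda>t. X t \<omega>)) * indicator B \<omega> =
      (\<Sum>x\<in>paths. ennreal (h x) * indicator (C x \<inter> B) \<omega>)"
    if "\<omega> \<in> space P" and h: "\<And>x y. (\<And>k. k \<le> n \<Longrightarrow> x k = y k) \<Longrightarrow> h x = h y" for h B \<omega>
  proof -
    define x0 where "x0 = restrict (\<lambda>t. X t \<omega>) {..n}"
    have x0: "x0 \<in> paths" using X_lt that by (auto simp: x0_def paths_def)
    have "x = x0" if "x \<in> paths" "\<omega> \<in> C x" for x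
      using that unfolding x0_def paths_def C_def
      by (intro PiE_ext[where k = "{..n}"]) (auto simp: PiE_iff)
    then have "(\<Sum>x\<in>paths. ennreal (h x) * indicator (C x \<inter> B) \<omega>) =
        (\<Sum>x\<in>{x0}. ennreal (h x) * indicator (C x \<inter> B) \<omega>)"
      using x0 paths_fin by (intro sum.mono_neutral_right) (auto split: split_indicator)
    moreover have "\<omega> \<in> C x0" using that by (simp add: C_def x0_def)
    moreover have "h x0 = h (\<lambda>t. X t \<omega>)" by (intro h) (simp add: x0_def)
    ultimately show ?thesis by (simp add: indicator_inter_arith)
  qed
  \<comment> \<open>Both sides of the claim have this form: on the left \<open>B\<close> is the
    event that the next state is \<open>j\<close>, on the right it is the whole space and the factor
    from \<open>M\<close> is part of \<open>h\<close>.\<close>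
  have integral: "(\<integral>\<^sup>+\<omega>. ennreal (h (\<lambda>t. X t \<omega>)) * indicator B \<omega> \<partial>P) =
      (\<Sum>x\<in>paths. ennreal (h x) * emeasure P (C x \<inter> B))"
    if h: "\<And>x y. (\<And>k. k \<le> n \<Longrightarrow> x k = y k) \<Longrightarrow> h x = h y" and [measurable]: "B \<in> events" for h B
  proof -
    have "(\<integral>\<^sup>+\<omega>. ennreal (h (\<lambda>t. X t \<omega>)) * indicator B \<omega> \<partial>P) =
        (\<integral>\<^sup>+\<omega>. (\<Sum>x\<in>paths. ennreal (h x) * indicator (C x \<inter> B) \<omega>) \<partial>P)"
      by (rule nn_integral_cong, rule decompose[of _ h], assumption, rule h)
    also have "\<dots> = (\<Sum>x\<in>paths. ennreal (h x) * emeasure P (C x \<inter> B))"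
      by (subst nn_integral_sum) (auto intro!: sum.cong simp: nn_integral_cmult_indicator)
    finally show ?thesis .
  qed
  let ?B = "{\<omega>\<in>space P. X (Suc n) \<omega> = j}"
  have trans: "prob (C x \<inter> ?B) = prob (C x) * M $$ (x n, j)" if x: "x \<in> paths" for x
  proof (cases "prob (C x) = 0")
    \<comment> \<open>The chain condition is silent about null paths; there both sides vanish by
      monotonicity.\<close>
    case True
    have "prob (C x \<inter> ?B) \<le> prob (C x)" by (intro finite_measure_mono) auto
    then show ?thesis using True measure_nonneg[of P "C x \<inter> ?B"] by simp
  next
    case False
    \<comment> \<open>In \<open>markov_chain\<close> a single sequence carries both the past and the
      next state, so the path is extended by \<open>j\<close> at time \<open>Suc n\<close>.\<close>
    define y where "y = x(Suc n := j)"
    have Cy: "{\<omega>\<in>space P. \<forall>k\<le>n. X k \<omega> = y k} = C x" by (auto simp: C_def y_def)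
    have "\<forall>k\<le>Suc n. y k < dim_row M"
      using x j by (auto simp: y_def paths_def d_def PiE_iff)
    moreover have "\<P>(\<omega> in P. \<forall>k\<le>n. X k \<omega> = y k) \<noteq> 0" using False Cy by simp
    ultimately have "\<P>(\<omega> in P. X (Suc n) \<omega> = y (Suc n) \<bar> \<forall>k\<le>n. X k \<omega> = y k) = M $$ (y n, y (Suc n))"
      using chain unfolding markov_chain_def by blast
    moreover have "{\<omega>\<in>space P. X (Suc n) \<omega> = y (Suc n) \<and> (\<forall>k\<le>n. X k \<omega> = y k)} = C x \<inter> ?B"
      by (auto simp: C_def y_def)
    ultimately have "prob (C x \<inter> ?B) / prob (C x) = M $$ (x n, j)"
      unfolding cond_prob_def Cy by (simp add: y_def)
    then show ?thesis using False by (simp add: field_simps)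
  qed
  have "(\<integral>\<^sup>+\<omega>. ennreal (g (\<lambda>t. X t \<omega>) * of_bool (X (Suc n) \<omega> = j)) \<partial>P) =
      (\<integral>\<^sup>+\<omega>. ennreal (g (\<lambda>t. X t \<omega>)) * indicator ?B \<omega> \<partial>P)"
    by (intro nn_integral_cong) (auto split: split_indicator)
  also have "\<dots> = (\<Sum>x\<in>paths. ennreal (g x) * emeasure P (C x \<inter> ?B))"
    by (rule integral[of g ?B], rule g_local, assumption) measurable
  also have "\<dots> = (\<Sum>x\<in>paths. ennreal (g x * M $$ (x n, j)) * emeasure P (C x \<inter> space P))"
  proof (intro sum.cong refl)
    fix x assume x: "x \<in> paths"
    then have "x n < dim_row M" by (auto simp: paths_def d_def PiE_iff)
    then have "0 \<le> M $$ (x n, j)" by (rule M_nonneg)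
    moreover have "C x \<inter> space P = C x" by (auto simp: C_def)
    ultimately show "ennreal (g x) * emeasure P (C x \<inter> ?B) =
        ennreal (g x * M $$ (x n, j)) * emeasure P (C x \<inter> space P)"
      using g_nonneg[of x] trans[OF x]
      by (simp add: emeasure_eq_measure ennreal_mult mult_ac)
  qed
  also have "\<dots> = (\<integral>\<^sup>+\<omega>. ennreal (g (\<lambda>t. X t \<omega>) * M $$ (X n \<omega>, j)) * indicator (space P) \<omega> \<partial>P)"
  proof (rule integral[of "\<lambda>x. g x * M $$ (x n, j)", symmetric])
    fix x y :: "nat \<Rightarrow> nat" assume "\<And>k. k \<le> n \<Longrightarrow> x k = y k"
    then show "g x * M $$ (x n, j) = g y * M $$ (y n, j)" using g_local[of x y] by simp
  qed simp
  also have "\<dots> = (\<integral>\<^sup>+\<omega>. ennreal (g (\<lambda>t. X t \<omega>) * M $$ (X n \<omega>, j)) \<partial>P)"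
    by (intro nn_integral_cong) simp
  finally show ?thesis .
qed

text \<open>Turns survival up to \<open>n\<close> into a condition on the times 1 to
  \<open>n\<close>, which makes the path weight local. A path that never returns needs no separate
  case, since the infimum of the empty set is infinite.\<close>

lemma less_return_time_iff:
  "enat n < return_time X i \<omega> \<longleftrightarrow> (\<forall>m. 1 \<le> m \<and> m \<le> n \<longrightarrow> X m \<omega> \<noteq> i)"
proof
  assume lt: "enat n < return_time X i \<omega>"
  show "\<forall>m. 1 \<le> m \<and> m \<le> n \<longrightarrow> X m \<omega> \<noteq> i"
  proof (intro allI impI notI)
    fix m assume m: "1 \<le> m \<and> m \<le> n" "X m \<omega> = i"
    then have "return_time X i \<omega> \<le> enat m"
      unfolding return_time_def by (intro Inf_lower) auto
    also have "\<dots> \<le> enat n" using m by simp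
    finally show False using lt by simp
  qed
next
  assume *: "\<forall>m. 1 \<le> m \<and> m \<le> n \<longrightarrow> X m \<omega> \<noteq> i"
  have "enat (Suc n) \<le> return_time X i \<omega>"
    unfolding return_time_def
  proof (rule Inf_greatest)
    fix t assume "t \<in> {enat m |m. 1 \<le> m \<and> X m \<omega> = i}"
    then obtain m where "t = enat m" "1 \<le> m" "X m \<omega> = i" by auto
    then have "Suc n \<le> m" using * by (metis not_less_eq_eq)
    then show "enat (Suc n) \<le> t" using \<open>t = enat m\<close> by simp
  qed
  then show "enat n < return_time X i \<omega>" using Suc_ile_eq by simp
qed

section \<open>The expectation over one excursion from a state\<close>

theorem corollary2:
  fixes d :: nat and A :: "real mat" and l :: real and mu :: "real vec"
    and P :: "nat \<Rightarrow> 'w measure" and X :: "nat \<Rightarrow> 'w \<Rightarrow> nat"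
  assumes "d \<ge> 1"
    and "A \<in> carrier_mat d d"
    and "\<And>i j. i < d \<Longrightarrow> j < d \<Longrightarrow> A $$ (i, j) > 0"
    and "perron_frobenius_eigenvalue A l"
    and "left_perron_frobenius_eigenvector A mu"
    and "\<And>i. i < d \<Longrightarrow> markov_chain (transition_matrix A) (P i) X"
    and "\<And>i. i < d \<Longrightarrow> AE \<omega> in P i. X 0 \<omega> = i"
  shows "\<forall>i<d. ereal (mu $ i) =
    1 / enn2ereal (\<integral>\<^sup>+ \<omega>. (\<Sum>n. if enat n < return_time X i \<omega>
                      then ennreal (l powi (- int n) * (\<Prod>t<n. row_sum A (X t \<omega>)))
                      else 0) \<partial>P i)"
proof (intro allI impI)
  fix i assume i: "i < d"
  note A = assms(2) and pos = assms(3)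
  let ?M = "transition_matrix A"
  have dims[simp]: "dim_row A = d" "dim_col A = d" "dim_row ?M = d"
    using A by (auto simp: transition_matrix_def)
  have l: "l = spectral_radius (map_mat complex_of_real A)"
    using assms(4) by (simp add: perron_frobenius_eigenvalue_def)
  \<comment> \<open>The eigenvalue hidden in \<open>left_perron_frobenius_eigenvector\<close> is the
    spectral radius as well, hence equal to \<open>l\<close>.\<close>
  have ev: "eigenvector (transpose_mat A) mu l" and sum_mu: "(\<Sum>j<dim_vec mu. mu $ j) = 1"
    using assms(5) by (auto simp: left_perron_frobenius_eigenvector_def perron_frobenius_eigenvalue_def l)
  have mu_dim[simp]: "dim_vec mu = d" using ev by (auto simp: eigenvector_def)
  have mu_eq: "(\<Sum>k<d. mu $ k * A $$ (k, j)) = l * mu $ j" if "j < d" for j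
  proof -
    have "(transpose_mat A *\<^sub>v mu) $ j = (l \<cdot>\<^sub>v mu) $ j" using ev by (simp add: eigenvector_def)
    then show ?thesis using that
      by (simp add: scalar_prod_def atLeast0LessThan mult.commute)
  qed
  have l_pos: "0 < l" and mu_pos: "\<And>j. j < d \<Longrightarrow> 0 < mu $ j"
    using left_perron_frobenius_positive[OF A _ pos l mu_eq] sum_mu assms(1) by auto
  have S_pos: "0 < row_sum A k" if "k < d" for k
    unfolding row_sum_def using that pos by (intro sum_pos) auto
  have M: "?M $$ (k, j) = A $$ (k, j) / row_sum A k" if "k < d" "j < d" for k j
    using that by (simp add: transition_matrix_def)

  have chain: "markov_chain ?M (P i) X" by (rule assms(6)[OF i])
  interpret prob_space "P i" using chain by (simp add: markov_chain_def)
  have X[measurable]: "X t \<in> measurable (P i) (count_space {..<d})" for t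
    using chain by (simp add: markov_chain_def)
  have X_lt: "X t \<omega> < d" if "\<omega> \<in> space (P i)" for t \<omega>
    using measurable_space[OF X that, of t] by simp

  \<comment> \<open>The weight of a path up to time \<open>n\<close>; the absolute value only serves to make it nonnegative
    on sequences that leave the state space.\<close>
  define W where "W n x = of_bool (\<forall>m. 1 \<le> m \<and> m \<le> n \<longrightarrow> x m \<noteq> i) *
      (\<Prod>t<n. \<bar>row_sum A (x t)\<bar> / l)" for n :: nat and x
  have W_nonneg: "0 \<le> W n x" for n x
    unfolding W_def using l_pos by (intro mult_nonneg_nonneg prod_nonneg) auto
  have W_local: "W n x = W n y" if "\<And>k. k \<le> n \<Longrightarrow> x k = y k" for n x y
  proof -
    have "(\<Prod>t<n. \<bar>row_sum A (x t)\<bar> / l) = (\<Prod>t<n. \<bar>row_sum A (y t)\<bar> / l)"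
      by (intro prod.cong) (auto simp: that[OF less_imp_le])
    then show ?thesis unfolding W_def using that by auto
  qed
  have W_meas[measurable]: "(\<lambda>\<omega>. W n (\<lambda>t. X t \<omega>)) \<in> borel_measurable (P i)" for n
  proof -
    have h: "(\<lambda>\<omega>. h (X t \<omega>)) \<in> borel_measurable (P i)" for h :: "nat \<Rightarrow> real" and t
      by (rule measurable_compose[OF X]) simp
    \<comment> \<open>Writing the bounded quantifier as a finite product of indicators reduces
      measurability to single coordinates.\<close>
    have "W n (\<lambda>t. X t \<omega>) = (\<Prod>m\<in>{1..n}. of_bool (X m \<omega> \<noteq> i)) * (\<Prod>t<n. \<bar>row_sum A (X t \<omega>)\<bar> / l)" for \<omega>
      by (auto simp: W_def)
    then show ?thesis
      by (simp only:) (intro borel_measurable_times borel_measurable_prod h)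
  qed
  have W_eq: "(if enat n < return_time X i \<omega>
        then ennreal (l powi (- int n) * (\<Prod>t<n. row_sum A (X t \<omega>))) else 0) = ennreal (W n (\<lambda>t. X t \<omega>))"
    if "\<omega> \<in> space (P i)" for n \<omega>
  proof -
    have "(\<Prod>t<n. \<bar>row_sum A (X t \<omega>)\<bar>) = (\<Prod>t<n. row_sum A (X t \<omega>))"
      using S_pos[OF X_lt[OF that]] by (intro prod.cong) (auto intro: abs_of_pos)
    then have "l powi (- int n) * (\<Prod>t<n. row_sum A (X t \<omega>)) = (\<Prod>t<n. \<bar>row_sum A (X t \<omega>)\<bar> / l)"
      by (simp add: prod_dividef power_int_minus field_simps)
    then show ?thesis
      by (simp only: W_def less_return_time_iff) auto
  qed

  define f where "f = rec_nat (\<lambda>j. of_bool (j = i))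
    (\<lambda>n g j. if j = i then 0 else \<Sum>k<d. g k * (A $$ (k, j) / l))"
  have f0: "f 0 j = of_bool (j = i)"
    and fSuc: "f (Suc n) j = (if j = i then 0 else \<Sum>k<d. f n k * (A $$ (k, j) / l))" for n j
    by (simp_all add: f_def)
  have f_nonneg: "0 \<le> f n j" if "j < d" for n j
    using that l_pos
    by (induction n arbitrary: j)
      (auto simp: f0 fSuc intro!: sum_nonneg mult_nonneg_nonneg divide_nonneg_nonneg less_imp_le[OF pos])
  have f_integral: "(\<integral>\<^sup>+\<omega>. ennreal (W n (\<lambda>t. X t \<omega>) * of_bool (X n \<omega> = j)) \<partial>P i) = ennreal (f n j)"
    if "j < d" for n j
    using that
  proof (induction n arbitrary: j)
    case 0
    have "(\<integral>\<^sup>+\<omega>. ennreal (W 0 (\<lambda>t. X t \<omega>) * of_bool (X 0 \<omega> = j)) \<partial>P i) = (\<integral>\<^sup>+\<omega>. ennreal (f 0 j) \<partial>P i)"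
      using assms(7)[OF i] by (intro nn_integral_cong_AE) (auto simp: W_def f0)
    then show ?case by (simp add: emeasure_space_1)
  next
    case (Suc n)
    show ?case
    proof (cases "j = i")
      case True
      \<comment> \<open>Being at \<open>i\<close> at time \<open>Suc n\<close> means that a return
        has occurred, so the weight is 0; this is the zeroed column.\<close>
      then have "(\<integral>\<^sup>+\<omega>. ennreal (W (Suc n) (\<lambda>t. X t \<omega>) * of_bool (X (Suc n) \<omega> = j)) \<partial>P i) = (\<integral>\<^sup>+\<omega>. 0 \<partial>P i)"
        by (intro nn_integral_cong) (auto simp: W_def)
      then show ?thesis using True by (simp add: fSuc)
    next
      case False
      \<comment> \<open>When the state at time \<open>Suc n\<close> is \<open>j\<close>, which
        differs from \<open>i\<close>, avoiding \<open>i\<close> at that time is automatic. What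
        remains of the weight depends only on the times up to \<open>n\<close>, so
        \<open>markov_chain_step\<close> applies.\<close>
      define g where "g x = W n x * (\<bar>row_sum A (x n)\<bar> / l)" for x
      have "(\<integral>\<^sup>+\<omega>. ennreal (W (Suc n) (\<lambda>t. X t \<omega>) * of_bool (X (Suc n) \<omega> = j)) \<partial>P i) =
          (\<integral>\<^sup>+\<omega>. ennreal (g (\<lambda>t. X t \<omega>) * of_bool (X (Suc n) \<omega> = j)) \<partial>P i)"
        using False by (intro nn_integral_cong arg_cong[where f = ennreal]) (auto simp: W_def g_def le_Suc_eq)
      also have "\<dots> = (\<integral>\<^sup>+\<omega>. ennreal (g (\<lambda>t. X t \<omega>) * ?M $$ (X n \<omega>, j)) \<partial>P i)"
      proof (rule markov_chain_step[OF chain])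
        show "0 \<le> ?M $$ (k, j)" if "k < dim_row ?M" for k
          using that pos[of k j] S_pos[of k] Suc.prems by (simp add: M less_imp_le)
        show "g x = g y" if "\<And>k. k \<le> n \<Longrightarrow> x k = y k" for x y
          using W_local[OF that] that[of n] by (simp add: g_def)
      qed (use Suc.prems l_pos W_nonneg in \<open>auto simp: g_def\<close>)
      \<comment> \<open>The last factor \<open>row_sum A\<close> in \<open>g\<close> cancels the
        denominator of the transition matrix; splitting by the value of \<open>X n\<close> exposes
        the integrals of the induction hypothesis.\<close>
      also have "\<dots> = (\<integral>\<^sup>+\<omega>. (\<Sum>k<d. ennreal (W n (\<lambda>t. X t \<omega>) * of_bool (X n \<omega> = k)) * ennreal (A $$ (k, j) / l)) \<partial>P i)"
      proof (rule nn_integral_cong)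
        fix \<omega> assume \<omega>: "\<omega> \<in> space (P i)"
        define m where "m = X n \<omega>"
        have m: "m < d" using X_lt[OF \<omega>] by (simp add: m_def)
        have "g (\<lambda>t. X t \<omega>) * ?M $$ (m, j) = W n (\<lambda>t. X t \<omega>) * (A $$ (m, j) / l)"
          using S_pos[OF m] by (simp add: g_def M[OF m Suc.prems] m_def[symmetric])
        moreover have "(\<Sum>k<d. ennreal (W n (\<lambda>t. X t \<omega>) * of_bool (m = k)) * ennreal (A $$ (k, j) / l)) =
            (\<Sum>k\<in>{m}. ennreal (W n (\<lambda>t. X t \<omega>) * of_bool (m = k)) * ennreal (A $$ (k, j) / l))"
          using m by (intro sum.mono_neutral_right) auto
        moreover have "ennreal (W n (\<lambda>t. X t \<omega>) * (A $$ (m, j) / l)) =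
            ennreal (W n (\<lambda>t. X t \<omega>)) * ennreal (A $$ (m, j) / l)"
          using W_nonneg pos[OF m Suc.prems] l_pos by (intro ennreal_mult) auto
        ultimately show "ennreal (g (\<lambda>t. X t \<omega>) * ?M $$ (X n \<omega>, j)) =
            (\<Sum>k<d. ennreal (W n (\<lambda>t. X t \<omega>) * of_bool (X n \<omega> = k)) * ennreal (A $$ (k, j) / l))"
          unfolding m_def[symmetric] by simp
      qed
      also have "\<dots> = (\<Sum>k<d. ennreal (f n k) * ennreal (A $$ (k, j) / l))"
        using Suc.IH by (subst nn_integral_sum) (auto simp: nn_integral_multc)
      also have "\<dots> = (\<Sum>k<d. ennreal (f n k * (A $$ (k, j) / l)))"
        using f_nonneg pos[OF _ Suc.prems] l_pos by (intro sum.cong refl ennreal_mult[symmetric]) (auto simp: less_imp_le)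
      also have "\<dots> = ennreal (f (Suc n) j)"
        using False f_nonneg pos[OF _ Suc.prems] l_pos
        by (subst sum_ennreal) (auto simp: fSuc less_imp_le)
      finally show ?thesis .
    qed
  qed
  have W_integral: "(\<integral>\<^sup>+\<omega>. ennreal (W n (\<lambda>t. X t \<omega>)) \<partial>P i) = ennreal (\<Sum>j<d. f n j)" for n
  proof -
    have "(\<integral>\<^sup>+\<omega>. ennreal (W n (\<lambda>t. X t \<omega>)) \<partial>P i) =
        (\<integral>\<^sup>+\<omega>. (\<Sum>j<d. ennreal (W n (\<lambda>t. X t \<omega>) * of_bool (X n \<omega> = j))) \<partial>P i)"
    proof (rule nn_integral_cong)
      fix \<omega> assume "\<omega> \<in> space (P i)"
      then have "(\<Sum>j<d. ennreal (W n (\<lambda>t. X t \<omega>) * of_bool (X n \<omega> = j))) =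
          (\<Sum>j\<in>{X n \<omega>}. ennreal (W n (\<lambda>t. X t \<omega>) * of_bool (X n \<omega> = j)))"
        using X_lt by (intro sum.mono_neutral_right) auto
      then show "ennreal (W n (\<lambda>t. X t \<omega>)) = (\<Sum>j<d. ennreal (W n (\<lambda>t. X t \<omega>) * of_bool (X n \<omega> = j)))"
        by simp
    qed
    also have "\<dots> = (\<Sum>j<d. ennreal (f n j))"
      using f_integral by (subst nn_integral_sum) auto
    also have "\<dots> = ennreal (\<Sum>j<d. f n j)"
      using f_nonneg by (intro sum_ennreal) auto
    finally show ?thesis .
  qed
  \<comment> \<open>Dividing \<open>mu\<close> by \<open>mu $ i\<close> gives the value 1 at
    \<open>i\<close>, and dividing \<open>A\<close> by \<open>l\<close> turns the eigenvector
    equation into a fixed-point equation.\<close>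
  have f_sums: "(\<lambda>n. f n j) sums (mu $ j / mu $ i)" if "j < d" for j
  proof (rule killed_iterates_sums[of i d "\<lambda>k j. A $$ (k, j) / l" "\<lambda>j. mu $ j / mu $ i" f])
    show "(\<Sum>k<d. mu $ k / mu $ i * (A $$ (k, j) / l)) = mu $ j / mu $ i" if "j < d" for j
      using mu_eq[OF that] l_pos by (simp flip: sum_divide_distrib)
  qed (use i that pos l_pos less_imp_neq[OF mu_pos[OF i]] mu_pos f0 fSuc in auto)
  have "(\<lambda>n. \<Sum>j<d. f n j) sums (\<Sum>j<d. mu $ j / mu $ i)"
    using f_sums by (intro sums_sum) auto
  also have "(\<Sum>j<d. mu $ j / mu $ i) = 1 / mu $ i"
    using sum_mu by (simp flip: sum_divide_distrib)
  finally have sums: "(\<lambda>n. \<Sum>j<d. f n j) sums (1 / mu $ i)" .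
  have "(\<integral>\<^sup>+\<omega>. (\<Sum>n. if enat n < return_time X i \<omega>
        then ennreal (l powi (- int n) * (\<Prod>t<n. row_sum A (X t \<omega>))) else 0) \<partial>P i) =
      (\<integral>\<^sup>+\<omega>. (\<Sum>n. ennreal (W n (\<lambda>t. X t \<omega>))) \<partial>P i)"
    using W_eq by (intro nn_integral_cong) simp
  also have "\<dots> = (\<Sum>n. ennreal (\<Sum>j<d. f n j))"
    by (subst nn_integral_suminf) (auto simp: W_integral)
  also have "\<dots> = ennreal (1 / mu $ i)"
    using f_nonneg sums by (intro suminf_ennreal_eq sum_nonneg) auto
  \<comment> \<open>Since \<open>mu $ i\<close> is positive, \<open>1 / mu $ i\<close> is neither
    truncated by \<open>ennreal\<close> nor zero, and its reciprocal in \<open>ereal\<close> is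
    \<open>mu $ i\<close>.\<close>
  finally show "ereal (mu $ i) = 1 / enn2ereal (\<integral>\<^sup>+\<omega>. (\<Sum>n. if enat n < return_time X i \<omega>
        then ennreal (l powi (- int n) * (\<Prod>t<n. row_sum A (X t \<omega>))) else 0) \<partial>P i)"
    using mu_pos[OF i] by (simp add: one_ereal_def divide_ereal_def)
qed

end
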